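(* Every $3$-irreducible numerical semigroup is irreducible.
   Context: $\mathbb{N}$ denotes the set of non-negative integers. A numerical semigroup is a subset $S\subseteq\mathbb{N}$ that is closed under addition, contains $0$ and has finite complement $\mathbb{N}\setminus S$. The multiplicity of $S$ is the smallest positive integer belonging to $S$. A numerical semigroup is irreducible if it cannot be expressed as an intersection of two numerical semigroups containing it properly. A numerical semigroup with multiplicity $m$ is $m$-irreducible if it cannot be expressed as an intersection of two numerical semigroups with multiplicity $m$ containing it properly; in particular a $3$-irreducible numerical semigroup has multiplicity $3$. *)

theory Defs
  imports Main
begin

definition numerical_semigroup :: "nat set \<Rightarrow> bool" where
  "numerical_semigroup S \<longleftrightarrow>
     0 \<in> S \<and> (\<forall>x\<in>S. \<forall>y\<in>S. x + y \<in> S) \<and> finite (UNIV - S)"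

text \<open>The complement of a numerical semigroup is finite, so a positive element exists
  and the least one is well-defined.\<close>

definition multiplicity :: "nat set \<Rightarrow> nat" where
  "multiplicity S = (LEAST n. 0 < n \<and> n \<in> S)"

definition irreducible_semigroup :: "nat set \<Rightarrow> bool" where
  "irreducible_semigroup S \<longleftrightarrow>
     numerical_semigroup S \<and>
     \<not> (\<exists>A B. numerical_semigroup A \<and> numerical_semigroup B \<and>
              S \<subset> A \<and> S \<subset> B \<and> S = A \<inter> B)"

definition m_irreducible_semigroup :: "nat \<Rightarrow> nat set \<Rightarrow> bool" where
  "m_irreducible_semigroup m S \<longleftrightarrow>
     numerical_semigroup S \<and> multiplicity S = m \<and>
     \<not> (\<exists>A B. numerical_semigroup A \<and> multiplicity A = m \<and>
              numerical_semigroup B \<and> multiplicity B = m \<and>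
              S \<subset> A \<and> S \<subset> B \<and> S = A \<inter> B)"

end

theory Submission
  imports Defs
begin

text \<open>
  Irreducibility could fail only through a decomposition \<open>S = A \<inter> B\<close> in which \<open>A\<close> or \<open>B\<close> has
  multiplicity other than 3. But a numerical semigroup that contains 3 and has another multiplicity
  contains 2, hence every number except possibly 1. Only \<open>\<nat>\<close> and \<open>\<nat> - {1}\<close> remain, and both are
  comparable under inclusion with every numerical semigroup
  (\<open>semigroup_missing_at_most_one_comparable\<close>). An intersection of comparable sets is one of the
  two, so neither semigroup can occur in a decomposition into proper oversemigroups: both parts have
  multiplicity 3, which 3-irreducibility forbids.
\<close>

lemma semigroup_with_one_eq_UNIV:
  assumes "numerical_semigroup A" and "1 \<in> A"
  shows "A = UNIV"
proof -
  have "n \<in> A" for n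
  proof (induction n)
    case 0
    then show ?case using assms by (simp add: numerical_semigroup_def)
  next
    case (Suc n)
    then have "n + 1 \<in> A" using assms unfolding numerical_semigroup_def by blast
    then show ?case by simp
  qed
  then show ?thesis by blast
qed

lemma semigroup_with_two_three:
  assumes A: "numerical_semigroup A" and "2 \<in> A" and "3 \<in> A" and "n \<noteq> 1"
  shows "n \<in> A"
  using \<open>n \<noteq> 1\<close>
proof (induction n rule: less_induct)
  case (less n)
  show ?case
  proof (cases "n = 0 \<or> n = 3")
    case True
    then show ?thesis using A \<open>3 \<in> A\<close> by (auto simp: numerical_semigroup_def)
  next
    \<comment> \<open>The value 3 is set apart because subtracting 2 from it would give the excluded value 1.\<close>
    case False
    then have "n - 2 \<in> A" and n: "n = (n - 2) + 2" using less by auto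
    then have "(n - 2) + 2 \<in> A"
      using A \<open>2 \<in> A\<close> unfolding numerical_semigroup_def by blast
    then show ?thesis using n by simp
  qed
qed

lemma semigroup_multiplicity_neq_three:
  assumes A: "numerical_semigroup A" and three: "3 \<in> A" and mult: "multiplicity A \<noteq> 3"
  shows "UNIV - {1} \<subseteq> A"
proof -
  have "0 < multiplicity A" and least_in: "multiplicity A \<in> A"
    using LeastI[of "\<lambda>n. 0 < n \<and> n \<in> A" 3] three by (auto simp: multiplicity_def)
  moreover have "multiplicity A \<le> 3"
    unfolding multiplicity_def using three by (intro Least_le) simp
  ultimately have "multiplicity A = 1 \<or> multiplicity A = 2"
    using mult by linarith
  then have "2 \<in> A"
    using least_in semigroup_with_one_eq_UNIV[OF A] by auto
  then show ?thesis
    using semigroup_with_two_three[OF A _ three] by auto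
qed

text \<open>
  The only number on which inclusion of \<open>B\<close> in \<open>A\<close> can fail is 1, and a semigroup that contains 1
  is all of \<open>\<nat>\<close>.
\<close>

lemma semigroup_missing_at_most_one_comparable:
  assumes "UNIV - {1} \<subseteq> A" and "numerical_semigroup B"
  shows "A \<subseteq> B \<or> B \<subseteq> A"
proof (cases "1 \<in> B")
  case True
  then show ?thesis using semigroup_with_one_eq_UNIV[OF assms(2)] by simp
next
  case False
  then have "B \<subseteq> UNIV - {1}" by blast
  then show ?thesis using assms(1) by (meson subset_trans)
qed

lemma proper_decomposition_multiplicity_three:
  assumes "numerical_semigroup A" and "numerical_semigroup B" and "3 \<in> S"
    and "S \<subset> A" and "S \<subset> B" and "S = A \<inter> B"
  shows "multiplicity A = 3"
proof (rule ccontr)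
  assume "multiplicity A \<noteq> 3"
  then have "UNIV - {1} \<subseteq> A"
    using semigroup_multiplicity_neq_three assms by blast
  then have "A \<subseteq> B \<or> B \<subseteq> A"
    using assms by (intro semigroup_missing_at_most_one_comparable)
  then show False using assms by blast
qed

theorem lemma9:
  fixes S :: "nat set"
  assumes "m_irreducible_semigroup 3 S"
  shows "irreducible_semigroup S"
proof -
  have S: "numerical_semigroup S" and mult: "multiplicity S = 3"
    using assms by (auto simp: m_irreducible_semigroup_def)
  have "infinite S"
    using S Diff_infinite_finite[of S UNIV] by (auto simp: numerical_semigroup_def)
  then have "\<not> S \<subseteq> {0}"
    using finite_subset by auto
  then obtain n where "0 < n" and "n \<in> S" by auto
  then have "multiplicity S \<in> S"
    using LeastI[of "\<lambda>n. 0 < n \<and> n \<in> S" n] by (simp add: multiplicity_def)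
  then have three: "3 \<in> S" using mult by simp
  have False
    if A: "numerical_semigroup A" and B: "numerical_semigroup B"
      and SA: "S \<subset> A" and SB: "S \<subset> B" and eq: "S = A \<inter> B" for A B
  proof -
    have "multiplicity A = 3"
      by (rule proper_decomposition_multiplicity_three[OF A B three SA SB eq])
    moreover have "multiplicity B = 3"
      using eq by (intro proper_decomposition_multiplicity_three[OF B A three SB SA]) blast
    ultimately show False
      using assms that unfolding m_irreducible_semigroup_def by blast
  qed
  then show ?thesis
    using S unfolding irreducible_semigroup_def by blast
qed

end
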